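(* Let $n\ge2$. There exists $A\in\mathbb{C}^{n\times n}$ that cannot be expressed as a product of $r$ symmetric Toeplitz matrices for any $r\in\mathbb{N}$.
   Context: All factors are $n\times n$ with complex entries. A matrix $(a_{ij})$ is Toeplitz if $a_{ij}$ depends only on $j-i$; it is symmetric if $a_{ij}=a_{ji}$ for all $i,j$. *)

theory Defs
  imports Complex_Main "Jordan_Normal_Form.Matrix"
begin

text \<open>Matrices carry their dimensions as values, with indices starting at 0.\<close>

definition toeplitz_mat :: "'a mat \<Rightarrow> bool" where
  "toeplitz_mat A \<longleftrightarrow>
     (\<exists>t :: int \<Rightarrow> 'a. \<forall>i < dim_row A. \<forall>j < dim_col A. A $$ (i, j) = t (int j - int i))"

definition symmetric_mat :: "'a mat \<Rightarrow> bool" where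
  "symmetric_mat A \<longleftrightarrow> dim_row A = dim_col A \<and>
     (\<forall>i < dim_row A. \<forall>j < dim_col A. A $$ (i, j) = A $$ (j, i))"

text \<open>
  The ordered product of a list of \<open>n\<close> by \<open>n\<close> matrices.  The size is a parameter because it
  determines the empty product.
\<close>

definition mat_list_prod :: "nat \<Rightarrow> 'a :: semiring_1 mat list \<Rightarrow> 'a mat" where
  "mat_list_prod n Ms = foldr (*) Ms (1\<^sub>m n)"

end

theory Submission
  imports Defs
begin

text \<open>
  The entry of a symmetric Toeplitz matrix at \<open>(i, j)\<close> depends only on \<open>\<bar>j - i\<bar>\<close>, and this quantity is
  preserved by the reversal \<open>i \<mapsto> n - 1 - i\<close> of both indices.  Every such matrix is therefore
  centrosymmetric, that is, it commutes with the exchange matrix \<open>J\<close>, which reverses the standard basis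
  (lemma \<open>centrosymmetric_mat_symmetric_toeplitz\<close>).  The matrices that commute with \<open>J\<close> contain the
  identity and are closed under multiplication, so all finite products stay inside this
  subspace (lemma \<open>centrosymmetric_mat_list_prod\<close>).  For \<open>n \<ge> 2\<close> the matrix unit
  with its only nonzero entry in the top left corner is not centrosymmetric, since the reversal moves
  that corner to the bottom right one.
\<close>

definition centrosymmetric_mat :: "'a mat \<Rightarrow> bool" where
  "centrosymmetric_mat A \<longleftrightarrow>
     (\<forall>i < dim_row A. \<forall>j < dim_col A. A $$ (dim_row A - Suc i, dim_col A - Suc j) = A $$ (i, j))"

text \<open>
  Reversing both indices replaces the difference \<open>j - i\<close> by \<open>i - j\<close>, hence on a square Toeplitz matrix
  it acts as transposition.
\<close>

lemma centrosymmetric_mat_symmetric_toeplitz: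
  assumes "symmetric_mat A" and "toeplitz_mat A"
  shows "centrosymmetric_mat A"
  unfolding centrosymmetric_mat_def
proof (intro allI impI)
  fix i j
  assume i: "i < dim_row A" and j: "j < dim_col A"
  have square: "dim_row A = dim_col A"
    and sym: "\<And>k l. k < dim_row A \<Longrightarrow> l < dim_col A \<Longrightarrow> A $$ (k, l) = A $$ (l, k)"
    using assms(1) by (auto simp: symmetric_mat_def)
  obtain t where t: "\<And>k l. k < dim_row A \<Longrightarrow> l < dim_col A \<Longrightarrow> A $$ (k, l) = t (int l - int k)"
    using assms(2) by (auto simp: toeplitz_mat_def)
  have "A $$ (dim_row A - Suc i, dim_col A - Suc j)
      = t (int (dim_col A - Suc j) - int (dim_row A - Suc i))"
    using i j by (intro t) auto
  also have "int (dim_col A - Suc j) - int (dim_row A - Suc i) = int i - int j"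
    using i j square by simp
  also have "t (int i - int j) = A $$ (j, i)"
    using i j square by (intro t[symmetric]) auto
  also have "\<dots> = A $$ (i, j)"
    using sym[OF i j] by simp
  finally show "A $$ (dim_row A - Suc i, dim_col A - Suc j) = A $$ (i, j)" .
qed

lemma centrosymmetric_mat_one: "centrosymmetric_mat (1\<^sub>m n)"
  by (auto simp: centrosymmetric_mat_def)

text \<open>
  Entrywise form of \<open>J (A B) J = (J A J) (J B J)\<close>, with exchange matrices of matching sizes: the reversal of the summation index plays the role of
  inserting \<open>J J = 1\<close> between the factors.
\<close>

lemma centrosymmetric_mat_mult:
  fixes A B :: "'a :: semiring_0 mat"
  assumes A: "centrosymmetric_mat A" and B: "centrosymmetric_mat B"
    and dim: "dim_col A = dim_row B"
  shows "centrosymmetric_mat (A * B)"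
  unfolding centrosymmetric_mat_def
proof (intro allI impI)
  fix i j
  assume "i < dim_row (A * B)" and "j < dim_col (A * B)"
  hence i: "i < dim_row A" and j: "j < dim_col B" by auto
  let ?m = "dim_row B" and ?i = "dim_row A - Suc i" and ?j = "dim_col B - Suc j"
  have entry: "(A * B) $$ (k, l) = (\<Sum>s<?m. A $$ (k, s) * B $$ (s, l))"
    if "k < dim_row A" "l < dim_col B" for k l
    using that dim by (simp add: scalar_prod_def atLeast0LessThan)
  have "(A * B) $$ (?i, ?j) = (\<Sum>s<?m. A $$ (?i, s) * B $$ (s, ?j))"
    using i j by (intro entry) auto
  also have "\<dots> = (\<Sum>s<?m. A $$ (?i, ?m - Suc s) * B $$ (?m - Suc s, ?j))"
    by (rule sum.nat_diff_reindex[symmetric])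
  also have "\<dots> = (\<Sum>s<?m. A $$ (i, s) * B $$ (s, j))"
    using A B i j dim by (intro sum.cong) (auto simp: centrosymmetric_mat_def)
  also have "\<dots> = (A * B) $$ (i, j)"
    by (rule entry[OF i j, symmetric])
  finally show "(A * B) $$ (dim_row (A * B) - Suc i, dim_col (A * B) - Suc j) = (A * B) $$ (i, j)"
    by simp
qed

lemma mat_list_prod_carrier:
  assumes "\<forall>M \<in> set Ms. M \<in> carrier_mat n n"
  shows "mat_list_prod n Ms \<in> carrier_mat n n"
  using assms by (induction Ms) (auto simp: mat_list_prod_def)

lemma centrosymmetric_mat_list_prod:
  assumes "\<forall>M \<in> set Ms. M \<in> carrier_mat n n \<and> centrosymmetric_mat M"
  shows "centrosymmetric_mat (mat_list_prod n Ms)"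
  using assms
proof (induction Ms)
  case Nil
  show ?case by (simp add: mat_list_prod_def centrosymmetric_mat_one)
next
  case (Cons M Ms)
  have "mat_list_prod n Ms \<in> carrier_mat n n"
    using Cons.prems by (intro mat_list_prod_carrier) simp
  hence "centrosymmetric_mat (M * mat_list_prod n Ms)"
    using Cons by (intro centrosymmetric_mat_mult) auto
  thus ?case by (simp add: mat_list_prod_def)
qed

theorem theorem6p2:
  fixes n :: nat
  assumes "n \<ge> 2"
  shows "\<exists>A \<in> (carrier_mat n n :: complex mat set). \<forall>r :: nat.
    \<not> (\<exists>Ms :: complex mat list. length Ms = r \<and>
         (\<forall>M \<in> set Ms. M \<in> carrier_mat n n \<and> symmetric_mat M \<and> toeplitz_mat M) \<and>
         A = mat_list_prod n Ms)"
proof -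
  define E :: "complex mat" where "E = mat n n (\<lambda>(i, j). if i = 0 \<and> j = 0 then 1 else 0)"
  have E: "E \<in> carrier_mat n n"
    by (simp add: E_def)
  have "\<not> centrosymmetric_mat E"
  proof
    assume "centrosymmetric_mat E"
    hence "E $$ (dim_row E - Suc 0, dim_col E - Suc 0) = E $$ (0, 0)"
      unfolding centrosymmetric_mat_def using assms E by simp
    thus False
      using assms by (simp add: E_def)
  qed
  moreover have "centrosymmetric_mat (mat_list_prod n Ms)"
    if "\<forall>M \<in> set Ms. M \<in> carrier_mat n n \<and> symmetric_mat M \<and> toeplitz_mat M"
    for Ms :: "complex mat list"
  proof (rule centrosymmetric_mat_list_prod)
    show "\<forall>M \<in> set Ms. M \<in> carrier_mat n n \<and> centrosymmetric_mat M"
      using that centrosymmetric_mat_symmetric_toeplitz by blast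
  qed
  ultimately have "E \<noteq> mat_list_prod n Ms"
    if "\<forall>M \<in> set Ms. M \<in> carrier_mat n n \<and> symmetric_mat M \<and> toeplitz_mat M"
    for Ms :: "complex mat list"
    using that by metis
  thus ?thesis
    by (intro bexI[OF _ E]) blast
qed

end
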